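(* For all integers $p\ge 2$ and $m\ge 0$, \begin{align*} &(-1)^p\sum_{n=1}^\infty\left\{\frac{H_n\zeta_n(p+2m+2)}{n^p}-\frac{H_n\zeta_n(p)}{n^{p+2m+2}}\right\}\\ &=\sum_{i=1}^{p+2m+1}(-1)^{i-1}\zeta(p+2m+3-i)\sum_{n=1}^\infty\left\{\sum_{j=2}^{p-1}\frac{\zeta_n(j)}{n^{p+i-j}}+2\frac{H_n}{n^{p-1+i}}\right\}\\ &\quad+\sum_{i=1}^{p+2m}(-1)^{i-1}\zeta(p+2m+2-i)\sum_{n=1}^\infty\left\{\sum_{j=2}^{p}\frac{\zeta_n(j)}{n^{p+i+1-j}}+2\frac{H_n}{n^{p+i}}\right\}\\ &\quad-\sum_{i=1}^{p-2}(-1)^{i-1}\zeta(p-i)\sum_{n=1}^\infty\left\{\sum_{j=2}^{p+2m+2}\frac{\zeta_n(j)}{n^{p+2m+i+3-j}}+2\frac{H_n}{n^{p+2m+2+i}}\right\}\\ &\quad-\sum_{i=1}^{p-1}(-1)^{i-1}\zeta(p+1-i)\sum_{n=1}^\infty\left\{\sum_{j=2}^{p+2m+1}\frac{\zeta_n(j)}{n^{p+2m+i+2-j}}+2\frac{H_n}{n^{p+2m+i+1}}\right\}\\ &\quad+(p+2m+3)I_{p-1,p+2m+3}(1)+(2m+2)I_{p,p+2m+2}(1)-(p+1)I_{p+1,p+2m+1}(1). \end{align*}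
   Context: $H_n=\sum_{j=1}^n 1/j$, $\zeta_n(k)=\sum_{j=1}^n j^{-k}$, $\zeta(s)=\sum_{n\ge1}n^{-s}$. Empty sums are zero. $\mathrm{Li}_p(x)=\sum_{n\ge1}x^n/n^p$, and for integers $a,b\ge1$, $I_{a,b}(1)=\int_0^1\frac{\mathrm{Li}_a(x)\mathrm{Li}_b(x)}{x}\,dx$. *)

theory Defs
  imports "HOL-Analysis.Analysis"
begin

text \<open>
  All arguments of the zeta function and all orders of the polylogarithms are natural numbers here.
  Series over \<open>n \<ge> 1\<close> are written as \<open>\<Sum>n. f (Suc n)\<close>, and the harmonic number \<open>H\<^sub>n\<close> is
  the constant \<^const>\<open>harm\<close>.
\<close>

definition zeta :: "nat \<Rightarrow> real" where
  "zeta s = (\<Sum>n. 1 / real (Suc n) ^ s)"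

definition zeta_partial :: "nat \<Rightarrow> nat \<Rightarrow> real" where
  "zeta_partial n k = (\<Sum>j=1..n. 1 / real j ^ k)"

definition Li :: "nat \<Rightarrow> real \<Rightarrow> real" where
  "Li p x = (\<Sum>n. x ^ Suc n / real (Suc n) ^ p)"

text \<open>
  The series for \<open>Li 1\<close> diverges at \<open>x = 1\<close>, and the integrand is \<open>0 / 0 = 0\<close> at \<open>x = 0\<close>;
  the values at these two points do not affect the integral.
\<close>

definition Li_integral :: "nat \<Rightarrow> nat \<Rightarrow> real" where
  "Li_integral a b = integral {0..1} (\<lambda>x. Li a x * Li b x / x)"

end

theory Submission
  imports Defs "HOL-Real_Asymp.Real_Asymp"
begin

text \<open>
  Write \<open>q = p + 2 m + 2\<close>, \<open>c\<^sub>e(n) = \<Sum>\<^bsub>2 \<le> j \<le> e\<^esub> \<zeta>\<^sub>n(j) / n\<^bsup>e + 1 - j\<^esup> + 2 H\<^sub>n / n\<^sup>e\<close> and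
  \<open>K\<^sub>b(n) = \<Sum>\<^sub>k 1 / (k\<^sup>b (n + k))\<close>. Partial fractions in \<open>k\<close> express \<open>K\<^sub>b(n)\<close> by zeta values and
  \<open>H\<^sub>n / n\<^sup>b\<close>, so each of the four sums over \<open>i\<close> is \<open>\<Sum>\<^sub>n c\<^sub>e(n) K\<^sub>b(n)\<close> up to a multiple of
  \<open>\<Sum>\<^sub>n c\<^sub>e(n) H\<^sub>n / n\<^sup>b\<close>, with \<open>(e, b) = (p-1, q), (p, q-1), (q, p-1), (q-1, p)\<close>.
  Up to \<open>(e + 1) / n\<^bsup>e + 1\<^esup>\<close>, the number \<open>c\<^sub>e(n)\<close> is the coefficient of \<open>x\<^sup>n\<close> in \<open>Li\<^sub>1(x) Li\<^sub>e(x)\<close>; hence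
  \<open>\<Sum>\<^sub>n c\<^sub>e(n) K\<^sub>b(n)\<close> is \<open>\<integral> Li\<^sub>1 Li\<^sub>e Li\<^sub>b / x + (e + 1) I\<^bsub>e + 1, b\<^esub>\<close>. The triple integrals
  are symmetric in \<open>e\<close> and \<open>b\<close> and cancel, and the terms with \<open>H\<^sub>n\<close> combine because
  \<open>c\<^sub>e(n) - c\<^bsub>e - 1\<^esub>(n) / n = \<zeta>\<^sub>n(e) / n\<close>.
\<close>

definition euler_coeff :: "nat \<Rightarrow> nat \<Rightarrow> real" where
  "euler_coeff e n = (\<Sum>j=2..e. zeta_partial n j / real n ^ (e + 1 - j)) + 2 * (harm n / real n ^ e)"

definition kernel_sum :: "nat \<Rightarrow> nat \<Rightarrow> real" where
  "kernel_sum b n = (\<Sum>k. 1 / (real (Suc k) ^ b * (real n + real (Suc k))))"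

definition triple_Li_integral :: "nat \<Rightarrow> nat \<Rightarrow> nat \<Rightarrow> real" where
  "triple_Li_integral a b c = integral {0..1} (\<lambda>x. Li a x * Li b x * Li c x / x)"

section \<open>Bounds and convergence for series of harmonic type\<close>

lemma zeta_partial_1: "zeta_partial n 1 = harm n"
  by (simp add: zeta_partial_def harm_def divide_inverse)

lemma zeta_partial_nonneg: "zeta_partial n k \<ge> 0"
  unfolding zeta_partial_def by (intro sum_nonneg) auto

lemma zeta_partial_le_harm:
  assumes "k \<ge> 1"
  shows "zeta_partial n k \<le> harm n"
  unfolding zeta_partial_1[symmetric] zeta_partial_def
  using assms by (intro sum_mono divide_left_mono power_increasing) auto

lemma harm_ge_0: "harm n \<ge> (0 :: real)"
  unfolding harm_def by (intro sum_nonneg) auto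

text \<open>\<open>harm n - ln n\<close> decreases from 1, so the terms are at most (1 + ln n)^2 /
  n^2, which is O(n^(-3/2)). This series is the majorant behind the convergence proofs that
  follow.\<close>

lemma summable_harm_squared: "summable (\<lambda>n. harm (Suc n) ^ 2 / real (Suc n) ^ 2 :: real)"
proof (rule summable_comparison_test_ev)
  show "\<forall>\<^sub>F n in sequentially. norm (harm (Suc n) ^ 2 / real (Suc n) ^ 2 :: real)
          \<le> (1 + ln (real (Suc n))) ^ 2 / real (Suc n) ^ 2"
  proof (intro always_eventually allI)
    fix n
    have "harm (Suc n) - ln (real (Suc n)) \<le> 1"
      using euler_mascheroni_sequence_decreasing[of 1 "Suc n"] by (simp add: harm_def)
    then show "norm (harm (Suc n) ^ 2 / real (Suc n) ^ 2 :: real)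
          \<le> (1 + ln (real (Suc n))) ^ 2 / real (Suc n) ^ 2"
      using harm_ge_0[of "Suc n"] by (auto intro!: divide_right_mono power_mono)
  qed
  have "(\<lambda>n. (1 + ln (real (Suc n))) ^ 2 / real (Suc n) ^ 2) \<in> O(\<lambda>n. real n powr (-3/2))"
    by real_asymp
  moreover have "summable (\<lambda>n. norm (real n powr (-3/2)))"
    by (simp add: summable_real_powr_iff)
  ultimately show "summable (\<lambda>n. (1 + ln (real (Suc n))) ^ 2 / real (Suc n) ^ 2)"
    by (rule summable_comparison_test_bigo[rotated])
qed

lemma summable_harm_div:
  assumes "r \<ge> 2"
  shows "summable (\<lambda>n. harm (Suc n) / real (Suc n) ^ r :: real)"
proof (rule summable_comparison_test'[OF summable_harm_squared])
  fix n :: nat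
  have "(1::real) \<le> harm (Suc n)"
    using harm_mono[of 1 "Suc n"] by (simp add: harm_def)
  then have "harm (Suc n) \<le> (harm (Suc n) ^ 2 :: real)"
    by (simp add: power2_eq_square)
  then have "harm (Suc n) / real (Suc n) ^ r \<le> harm (Suc n) ^ 2 / real (Suc n) ^ 2"
    using assms \<open>1 \<le> _\<close> by (intro frac_le power_increasing) auto
  then show "norm (harm (Suc n) / real (Suc n) ^ r :: real) \<le> harm (Suc n) ^ 2 / real (Suc n) ^ 2"
    using harm_ge_0[of "Suc n"] by simp
qed

lemma sums_zeta:
  assumes "s \<ge> 2"
  shows "(\<lambda>n. 1 / real (Suc n) ^ s) sums zeta s"
proof -
  have "summable (\<lambda>n. 1 / real n ^ s)"
    using inverse_power_summable[OF assms, where 'a = real] by (simp add: divide_inverse)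
  then show ?thesis
    unfolding zeta_def using summable_Suc_iff[of "\<lambda>n. 1 / real n ^ s"] by (simp add: summable_sums)
qed

lemma euler_coeff_nonneg: "euler_coeff e n \<ge> 0"
  unfolding euler_coeff_def using harm_ge_0[of n]
  by (intro add_nonneg_nonneg sum_nonneg) (auto intro!: divide_nonneg_nonneg zeta_partial_nonneg)

text \<open>Each of the e - 1 summands, and H_n / n^e twice, is at most H_n / n, because zeta_n(j)
  \<le> H_n and all exponents are at least 1. This makes (e - 1) + 2 = e + 1 copies.\<close>

lemma euler_coeff_le:
  assumes "e \<ge> 1" "n \<ge> 1"
  shows "euler_coeff e n \<le> (real e + 1) * (harm n / real n)"
proof -
  have frac: "z / real n ^ r \<le> harm n / real n" if "r \<ge> 1" "z \<le> harm n" for r and z :: real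
  proof -
    have "real n ^ 1 \<le> real n ^ r"
      using that assms by (intro power_increasing) auto
    then show ?thesis
      using that assms harm_ge_0[of n] by (intro frac_le) auto
  qed
  have "(\<Sum>j=2..e. zeta_partial n j / real n ^ (e + 1 - j)) \<le> (\<Sum>j=2..e. harm n / real n)"
    by (intro sum_mono frac zeta_partial_le_harm) auto
  also have "\<dots> = (real e - 1) * (harm n / real n)"
    using assms by (simp add: of_nat_diff)
  finally show ?thesis
    unfolding euler_coeff_def using frac[of e "harm n"] assms unfolding ring_distribs by linarith
qed

text \<open>\<open>euler_coeff\<close> already decays like H_n / n, so i = 1 is enough: the terms
  are dominated by multiples of H_n / n^2 and H_n^2 / n^2.\<close>

lemma summable_euler_coeff:
  assumes "e \<ge> 1" "i \<ge> 1"
  shows "summable (\<lambda>n. euler_coeff e (Suc n) / real (Suc n) ^ i)"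
    and "summable (\<lambda>n. euler_coeff e (Suc n) * harm (Suc n) / real (Suc n) ^ i)"
proof -
  have bound: "euler_coeff e (Suc n) / real (Suc n) ^ i \<le> (real e + 1) * (harm (Suc n) / real (Suc n) ^ 2)"
    for n
  proof -
    have "euler_coeff e (Suc n) / real (Suc n) ^ i \<le> (real e + 1) * (harm (Suc n) / real (Suc n)) / real (Suc n) ^ 1"
      using assms harm_ge_0[of "Suc n"] by (intro frac_le euler_coeff_le power_increasing) auto
    then show ?thesis by (simp add: power2_eq_square)
  qed
  show "summable (\<lambda>n. euler_coeff e (Suc n) / real (Suc n) ^ i)"
    by (rule summable_comparison_test'[OF summable_mult[OF summable_harm_div, of 2 "real e + 1"]])
       (use bound euler_coeff_nonneg in auto)
  show "summable (\<lambda>n. euler_coeff e (Suc n) * harm (Suc n) / real (Suc n) ^ i)"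
  proof (rule summable_comparison_test'[OF summable_mult[OF summable_harm_squared, of "real e + 1"]])
    fix n :: nat
    show "norm (euler_coeff e (Suc n) * harm (Suc n) / real (Suc n) ^ i)
            \<le> (real e + 1) * (harm (Suc n) ^ 2 / real (Suc n) ^ 2)"
      using mult_right_mono[OF bound harm_ge_0[of "Suc n"], of n] euler_coeff_nonneg[of e "Suc n"] harm_ge_0[of "Suc n"]
      by (simp add: power2_eq_square algebra_simps)
  qed
qed

section \<open>Partial fractions for the kernel sums\<close>

text \<open>Passing from n to n + 1 adds a telescoping series with sum 1 / (n + 1).\<close>

lemma sums_inverse_diff_harm: "(\<lambda>k. 1 / real (Suc k) - 1 / (real n + real (Suc k))) sums harm n"
proof (induction n)
  case (Suc n)
  have "(\<lambda>k. 1 / (real n + real (Suc k))) \<longlonglongrightarrow> 0"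
    by real_asymp
  from telescope_sums'[OF this]
  have "(\<lambda>k. 1 / (real n + real (Suc k)) - 1 / (real (Suc n) + real (Suc k))) sums (1 / real (Suc n))"
    by (simp add: algebra_simps)
  from sums_add[OF Suc this] show ?case
    by (simp add: harm_Suc divide_inverse)
qed (simp add: harm_def)

text \<open>One partial fraction step gives K_{b+1}(n) = (zeta(b + 1) - K_b(n)) / n. Iterating it
  down to K_1(n) = H_n / n produces the alternating sum.\<close>

lemma kernel_sums:
  assumes "n \<ge> 1" "b \<ge> 1"
  shows "(\<lambda>k. 1 / (real (Suc k) ^ b * (real n + real (Suc k)))) sums
           ((\<Sum>i=1..b-1. (-1) ^ (i - 1) * zeta (b + 1 - i) / real n ^ i) + (-1) ^ (b - 1) * harm n / real n ^ b)"
  using assms(2)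
proof (induction b rule: dec_induct)
  case base
  have "1 / (real (Suc k) ^ 1 * (real n + real (Suc k))) = (1 / real (Suc k) - 1 / (real n + real (Suc k))) / real n" for k
    using assms(1) by (simp add: divide_simps) 
  then show ?case
    using sums_divide[OF sums_inverse_diff_harm, of n "real n"] by simp
next
  case (step b)
  have kstep: "1 / (real (Suc k) ^ Suc b * (real n + real (Suc k)))
      = (1 / real (Suc k) ^ Suc b - 1 / (real (Suc k) ^ b * (real n + real (Suc k)))) / real n" for k
  proof -
    have "1 / (x ^ Suc b * (y + x)) = (1 / x ^ Suc b - 1 / (x ^ b * (y + x))) / y" if "x > 0" "y > 0" for x y :: real
    proof -
      have "y + x > 0" using that by simp
      then show ?thesis using that by (simp add: divide_simps)
    qed
    then show ?thesis using assms(1) by simp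
  qed
  \<comment> \<open>The term i = 1 is the new zeta value; shifting the remaining indices by one
    costs a sign and a factor 1 / n.\<close>
  have "(\<Sum>i=1..b. (-1) ^ (i - 1) * zeta (Suc b + 1 - i) / real n ^ i)
      = zeta (Suc b) / real n + (\<Sum>i=2..b. (-1) ^ (i - 1) * zeta (Suc b + 1 - i) / real n ^ i)"
    using step.hyps by (simp add: sum.atLeast_Suc_atMost numeral_2_eq_2)
  also have "(\<Sum>i=2..b. (-1) ^ (i - 1) * zeta (Suc b + 1 - i) / real n ^ i)
      = (\<Sum>i=1..b-1. - ((-1) ^ (i - 1) * zeta (b + 1 - i) / real n ^ i) / real n)"
    by (rule sum.reindex_bij_witness[of _ Suc "\<lambda>i. i - 1"]) (auto simp: power_eq_if)
  also have "\<dots> = - (\<Sum>i=1..b-1. (-1) ^ (i - 1) * zeta (b + 1 - i) / real n ^ i) / real n"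
    by (simp add: sum_negf sum_divide_distrib)
  finally have sum: "(\<Sum>i=1..b. (-1) ^ (i - 1) * zeta (Suc b + 1 - i) / real n ^ i)
      = zeta (Suc b) / real n - (\<Sum>i=1..b-1. (-1) ^ (i - 1) * zeta (b + 1 - i) / real n ^ i) / real n"
    by simp
  have sgn: "(- 1) ^ b = - ((- 1) ^ (b - 1) :: real)"
    using step.hyps by (simp add: power_eq_if)
  have value_eq: "(\<Sum>i=1..Suc b - 1. (-1) ^ (i - 1) * zeta (Suc b + 1 - i) / real n ^ i) + (-1) ^ (Suc b - 1) * harm n / real n ^ Suc b
      = (zeta (Suc b) - ((\<Sum>i=1..b-1. (-1) ^ (i - 1) * zeta (b + 1 - i) / real n ^ i) + (-1) ^ (b - 1) * harm n / real n ^ b)) / real n"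
    unfolding diff_Suc_1 sum sgn by (simp add: diff_divide_distrib add_divide_distrib)
  show ?case
    unfolding kstep value_eq using step.hyps by (intro sums_divide sums_diff sums_zeta step.IH) simp
qed

lemma kernel_sum_eq:
  assumes "n \<ge> 1" "b \<ge> 1"
  shows "kernel_sum b n =
    (\<Sum>i=1..b-1. (-1) ^ (i - 1) * zeta (b + 1 - i) / real n ^ i) + (-1) ^ (b - 1) * harm n / real n ^ b"
  unfolding kernel_sum_def using sums_unique[OF kernel_sums[OF assms]] by simp

text \<open>First evaluation of the series: after inserting the finite expansion of
  \<open>kernel_sum\<close>, every piece converges separately, so linearity is enough.\<close>

lemma sums_euler_coeff_kernel:
  assumes "e \<ge> 1" "b \<ge> 1"
  shows "(\<lambda>n. euler_coeff e (Suc n) * kernel_sum b (Suc n)) sums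
    ((\<Sum>i=1..b-1. (-1) ^ (i - 1) * zeta (b + 1 - i) * (\<Sum>n. euler_coeff e (Suc n) / real (Suc n) ^ i))
     + (-1) ^ (b - 1) * (\<Sum>n. euler_coeff e (Suc n) * harm (Suc n) / real (Suc n) ^ b))"
proof -
  have split: "euler_coeff e (Suc n) * kernel_sum b (Suc n) =
      (\<Sum>i=1..b-1. (-1) ^ (i - 1) * zeta (b + 1 - i) * (euler_coeff e (Suc n) / real (Suc n) ^ i))
      + (-1) ^ (b - 1) * (euler_coeff e (Suc n) * harm (Suc n) / real (Suc n) ^ b)" for n
    using assms(2) by (simp add: kernel_sum_eq distrib_left sum_distrib_left mult_ac del: of_nat_Suc)
  then show ?thesis
    unfolding split using assms
    by (intro sums_add sums_sum sums_mult summable_sums summable_euler_coeff) auto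
qed

section \<open>Termwise integration of products of power series\<close>

lemma nn_integral_power_unit_interval:
  "(\<integral>\<^sup>+x. ennreal (x ^ m * indicator {0..1} x) \<partial>lborel) = ennreal (1 / real (Suc m))"
proof -
  have "(\<integral>\<^sup>+x. ennreal (x ^ m * indicator {0..1} x) \<partial>lborel) = (\<integral>\<^sup>+x. ennreal (x ^ m) * indicator {0..1} x \<partial>lborel)"
    by (intro nn_integral_cong) (auto simp: indicator_def)
  also have "\<dots> = ennreal (1 ^ Suc m / real (Suc m) - 0 ^ Suc m / real (Suc m))"
    by (intro nn_integral_FTC_Icc) (auto intro!: derivative_eq_intros simp del: power_Suc of_nat_Suc)
  finally show ?thesis by simp
qed

text \<open>Tonelli: F G / x is the double series of f n g k x^(n+k+1), and each monomial integrates
  to 1 / ((n + 1) + (k + 1)). Nonnegativity permits every interchange, and finiteness of S then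
  yields integrability. The expansions are required only on the open interval, since the series of
  \<open>Li 1\<close> diverges at 1.\<close>

lemma has_integral_power_series_product:
  fixes f g :: "nat \<Rightarrow> real"
  assumes f: "\<And>n. f n \<ge> 0" and g: "\<And>n. g n \<ge> 0"
    and F: "\<And>x. 0 < x \<Longrightarrow> x < 1 \<Longrightarrow> (\<lambda>n. f n * x ^ Suc n) sums F x"
    and G: "\<And>x. 0 < x \<Longrightarrow> x < 1 \<Longrightarrow> (\<lambda>n. g n * x ^ Suc n) sums G x"
    and K: "\<And>n. (\<lambda>k. g k / (real (Suc n) + real (Suc k))) sums K n"
    and S: "(\<lambda>n. f n * K n) sums S"
  shows "((\<lambda>x. F x * G x / x) has_integral S) {0..1}"
proof -
  \<comment> \<open>Built from the series and not from F and G, about which nothing is known outside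
    the open interval; this makes h Borel measurable.\<close>
  define h where "h x = (\<Sum>n. f n * x ^ Suc n) * (\<Sum>n. g n * x ^ Suc n) / x * indicator {0<..<1} x" for x :: real
  have K_nonneg: "K n \<ge> 0" for n
    using g by (intro sums_le[OF _ sums_zero K]) (auto intro!: divide_nonneg_nonneg)
  have h_eq: "h x = F x * G x / x" if "0 < x" "x < 1" for x
    using that sums_unique[OF F[OF that]] sums_unique[OF G[OF that]] by (simp add: h_def)
  \<comment> \<open>At x = 0 both sides vanish. At x = 1 the indicator on the right is 1 while h is
    0, so this null set is left out.\<close>
  have h_series: "ennreal (h x) = (\<Sum>n. \<Sum>k. ennreal (f n * g k * (x ^ (n + k + 1) * indicator {0..1} x)))"
    if "x \<noteq> 1" for x
  proof (cases "0 < x \<and> x < 1")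
    case True
    then have x: "0 < x" "x < 1" by auto
    have G_nonneg: "G x \<ge> 0"
      using g x by (intro sums_le[OF _ sums_zero G]) auto
    have inner: "(\<lambda>k. f n * g k * (x ^ (n + k + 1) * indicator {0..1} x)) sums (f n * x ^ n * G x)" for n
    proof -
      have "f n * g k * (x ^ (n + k + 1) * indicator {0..1} x) = f n * x ^ n * (g k * x ^ Suc k)" for k
        using x by (simp add: power_add)
      then show ?thesis using sums_mult[OF G[OF x], of "f n * x ^ n"] by (simp only:)
    qed
    have "(\<Sum>n. \<Sum>k. ennreal (f n * g k * (x ^ (n + k + 1) * indicator {0..1} x))) = (\<Sum>n. ennreal (f n * x ^ n * G x))"
      using f g x by (intro suminf_cong suminf_ennreal_eq[OF _ inner]) (auto simp: indicator_def)
    also have "\<dots> = ennreal (F x * G x / x)"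
    proof (rule suminf_ennreal_eq)
      show "(\<lambda>n. f n * x ^ n * G x) sums (F x * G x / x)"
      proof -
        have "f n * x ^ n * G x = f n * x ^ Suc n * (G x / x)" for n
          using x by simp
        then show ?thesis
          using sums_mult2[OF F[OF x], of "G x / x"] by (simp only: times_divide_eq_right[of "F x"])
      qed
    qed (use f x G_nonneg in auto)
    finally show ?thesis using h_eq[OF x] by simp
  next
    case False
    then have "ennreal (f n * g k * (x ^ (n + k + 1) * indicator {0..1} x)) = 0" for n k
      using that by (auto simp: indicator_def)
    then show ?thesis using False by (simp add: h_def)
  qed
  have h_nonneg: "h x \<ge> 0" for x
  proof (cases "0 < x \<and> x < 1")
    case True
    then have x: "0 < x" "x < 1" by auto
    have "F x \<ge> 0"
      by (rule sums_le[OF _ sums_zero F[OF x]]) (use f x in auto)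
    moreover have "G x \<ge> 0"
      by (rule sums_le[OF _ sums_zero G[OF x]]) (use g x in auto)
    ultimately show ?thesis
      using x by (simp add: h_eq)
  qed (auto simp: h_def)
  have [measurable]: "h \<in> borel_measurable borel"
    unfolding h_def by measurable
  have "(\<integral>\<^sup>+x. ennreal (h x) \<partial>lborel)
      = (\<integral>\<^sup>+x. (\<Sum>n. \<Sum>k. ennreal (f n * g k * (x ^ (n + k + 1) * indicator {0..1} x))) \<partial>lborel)"
    using h_series AE_lborel_singleton[of 1] by (intro nn_integral_cong_AE) auto
  also have "\<dots> = (\<Sum>n. \<Sum>k. \<integral>\<^sup>+x. ennreal (f n * g k * (x ^ (n + k + 1) * indicator {0..1} x)) \<partial>lborel)"
    by (simp add: nn_integral_suminf)
  also have "\<dots> = (\<Sum>n. \<Sum>k. ennreal (f n * (g k / (real (Suc n) + real (Suc k)))))"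
  proof -
    have "(\<integral>\<^sup>+x. ennreal (f n * g k * (x ^ (n + k + 1) * indicator {0..1} x)) \<partial>lborel)
        = ennreal (f n * (g k / (real (Suc n) + real (Suc k))))" for n k
    proof -
      have "(\<integral>\<^sup>+x. ennreal (f n * g k * (x ^ (n + k + 1) * indicator {0..1} x)) \<partial>lborel)
          = (\<integral>\<^sup>+x. ennreal (f n * g k) * ennreal (x ^ (n + k + 1) * indicator {0..1} x) \<partial>lborel)"
        using f g by (intro nn_integral_cong) (simp add: ennreal_mult')
      also have "\<dots> = ennreal (f n * g k) * ennreal (1 / real (Suc (n + k + 1)))"
        by (subst nn_integral_cmult) (auto simp only: nn_integral_power_unit_interval, measurable)
      also have "\<dots> = ennreal (f n * (g k / (real (Suc n) + real (Suc k))))"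
        using f g by (subst ennreal_mult'[symmetric]) (auto simp: algebra_simps)
      finally show ?thesis .
    qed
    then show ?thesis by simp
  qed
  also have "\<dots> = (\<Sum>n. ennreal (f n * K n))"
    using f g by (intro suminf_cong suminf_ennreal_eq sums_mult K) auto
  also have "\<dots> = ennreal S"
    using f K_nonneg S by (intro suminf_ennreal_eq) auto
  finally have "(h has_integral S) UNIV"
    using f K_nonneg S h_nonneg by (intro nn_integral_has_integral) (auto intro: sums_le[OF _ sums_zero S])
  moreover have "h = (\<lambda>x. if x \<in> {0<..<1} then F x * G x / x else 0)"
    using h_eq by (auto simp: h_def fun_eq_iff)
  ultimately show ?thesis
    unfolding has_integral_Icc_iff_Ioo by (simp only: has_integral_restrict_UNIV)
qed

section \<open>Power series of polylogarithms and of \<open>Li 1 x * Li e x\<close>\<close>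

lemma Li_sums:
  assumes "0 < x" "x < 1"
  shows "(\<lambda>n. 1 / real (Suc n) ^ p * x ^ Suc n) sums Li p x"
proof -
  have "summable (\<lambda>n. x ^ Suc n / real (Suc n) ^ p)"
  proof (rule summable_comparison_test'[OF summable_geometric[of x]])
    fix n
    have "x ^ Suc n / real (Suc n) ^ p \<le> x ^ n / 1"
      using assms by (intro frac_le) (auto simp: mult_le_cancel_right1)
    then show "norm (x ^ Suc n / real (Suc n) ^ p) \<le> x ^ n"
      using assms by simp
  qed (use assms in auto)
  then show ?thesis
    unfolding Li_def by (simp add: summable_sums)
qed

text \<open>The coefficient of x^(n+1), not of x^n, in \<open>Li 1 x * Li e x\<close>. It is an
  empty sum for n = 0, as the product starts at x^2.\<close>

definition Li1_Li_coeff :: "nat \<Rightarrow> nat \<Rightarrow> real" where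
  "Li1_Li_coeff e n = (\<Sum>i<n. 1 / (real (n - i) * real (Suc i) ^ e))"

lemma Li1_Li_sums:
  assumes x: "0 < x" "x < 1"
  shows "(\<lambda>n. Li1_Li_coeff e n * x ^ Suc n) sums (Li 1 x * Li e x)"
proof -
  define a b where "a n = 1 / real (Suc n) ^ e * x ^ Suc n" and "b n = 1 / real (Suc n) ^ 1 * x ^ Suc n" for n
  have "summable (\<lambda>n. norm (a n))" "summable (\<lambda>n. norm (b n))"
    using sums_summable[OF Li_sums[OF x, of e]] sums_summable[OF Li_sums[OF x, of 1]] x by (simp_all add: a_def b_def)
  from Cauchy_product_sums[OF this]
  have "(\<lambda>n. \<Sum>i\<le>n. a i * b (n - i)) sums (Li e x * Li 1 x)"
    unfolding a_def b_def using sums_unique[OF Li_sums[OF x, of e]] sums_unique[OF Li_sums[OF x, of 1]] by simp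
  also have "(\<lambda>n. \<Sum>i\<le>n. a i * b (n - i)) = (\<lambda>n. Li1_Li_coeff e (Suc n) * x ^ Suc (Suc n))"
  proof
    fix n
    have "a i * b (n - i) = 1 / (real (Suc n - i) * real (Suc i) ^ e) * x ^ Suc (Suc n)" if "i \<le> n" for i
    proof -
      have "x ^ Suc (Suc n) = x ^ Suc i * x ^ Suc (n - i)"
        using that by (simp flip: power_add)
      then show ?thesis
        using that by (simp add: a_def b_def Suc_diff_le del: of_nat_Suc power_Suc)
    qed
    then show "(\<Sum>i\<le>n. a i * b (n - i)) = Li1_Li_coeff e (Suc n) * x ^ Suc (Suc n)"
      unfolding Li1_Li_coeff_def sum_distrib_right lessThan_Suc_atMost by (intro sum.cong) auto
  qed
  \<comment> \<open>The Cauchy product supplies the coefficients from index 1 on; the one at index 0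
    is zero.\<close>
  finally show ?thesis
    using sums_Suc_iff[of "\<lambda>n. Li1_Li_coeff e n * x ^ Suc n"] by (simp add: Li1_Li_coeff_def mult.commute)
qed

text \<open>Partial fractions of \<open>1 / (a b\<^sup>e)\<close> with respect to \<open>b\<close>, where \<open>a + b = n + 1\<close>.\<close>

lemma Li1_Li_coeff_eq:
  assumes "e \<ge> 1"
  shows "Li1_Li_coeff e n = euler_coeff e (Suc n) - (real e + 1) / real (Suc n) ^ (e + 1)"
proof -
  \<comment> \<open>Here b runs only up to n, so the last term of zeta_{n+1}(j) has to be removed;
    these removed terms cause the correction in the statement.\<close>
  have zsplit: "(\<Sum>i<n. 1 / real (Suc i) ^ j) = zeta_partial (Suc n) j - 1 / real (Suc n) ^ j" for j
    unfolding zeta_partial_def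
    using sum.atLeast1_atMost_eq[of "\<lambda>i. 1 / real i ^ j" n] by (simp del: of_nat_Suc)
  have hsplit: "(\<Sum>i<n. 1 / real (n - i)) = harm (Suc n) - 1 / real (Suc n)"
  proof -
    have "(\<Sum>i<n. 1 / real (n - i)) = (\<Sum>i<n. 1 / real (Suc i) ^ 1)"
      by (rule sum.reindex_bij_witness[of _ "\<lambda>i. n - 1 - i" "\<lambda>i. n - 1 - i"]) auto
    then show ?thesis using zsplit[of 1] by (simp only: zeta_partial_1) simp
  qed
  \<comment> \<open>Induction on e through 1 / (a b) = (1 / a + 1 / b) / (a + b).\<close>
  have pf: "1 / (a * b ^ e) = (\<Sum>j=1..e. 1 / ((a + b) ^ (e + 1 - j) * b ^ j)) + 1 / ((a + b) ^ e * a)"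
    if "a > 0" "b > 0" for a b :: real
  proof (induction e)
    case (Suc e)
    have pos: "a + b > 0" using that by simp
    have "1 / (a * b ^ Suc e) = 1 / (a * b ^ e) / (a + b) + 1 / ((a + b) * b ^ Suc e)"
      using that pos by (simp add: divide_simps)
    also have "1 / (a * b ^ e) / (a + b) = (\<Sum>j=1..e. 1 / ((a + b) ^ (Suc e + 1 - j) * b ^ j)) + 1 / ((a + b) ^ Suc e * a)"
      unfolding Suc by (auto simp: add_divide_distrib sum_divide_distrib Suc_diff_le mult_ac intro!: sum.cong)
    finally show ?case by simp
  qed simp
  have "Li1_Li_coeff e n = (\<Sum>i<n. (\<Sum>j=1..e. 1 / (real (Suc n) ^ (e + 1 - j) * real (Suc i) ^ j)) + 1 / (real (Suc n) ^ e * real (n - i)))"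
    unfolding Li1_Li_coeff_def
  proof (rule sum.cong)
    fix i assume "i \<in> {..<n}"
    then have i: "real (n - i) > 0" "real (n - i) + real (Suc i) = real (Suc n)" by (auto simp: of_nat_diff)
    show "1 / (real (n - i) * real (Suc i) ^ e) =
        (\<Sum>j=1..e. 1 / (real (Suc n) ^ (e + 1 - j) * real (Suc i) ^ j)) + 1 / (real (Suc n) ^ e * real (n - i))"
      using pf[OF i(1), of "real (Suc i)"] unfolding i(2) by simp
  qed simp
  also have "\<dots> = (\<Sum>j=1..e. (\<Sum>i<n. 1 / real (Suc i) ^ j) / real (Suc n) ^ (e + 1 - j)) + (\<Sum>i<n. 1 / real (n - i)) / real (Suc n) ^ e"
    unfolding sum.distrib sum_divide_distrib by (subst sum.swap) (simp add: mult_ac)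
  also have "(\<Sum>j=1..e. (\<Sum>i<n. 1 / real (Suc i) ^ j) / real (Suc n) ^ (e + 1 - j))
      = (\<Sum>j=1..e. zeta_partial (Suc n) j / real (Suc n) ^ (e + 1 - j) - 1 / real (Suc n) ^ (e + 1))"
    unfolding zsplit by (intro sum.cong) (auto simp: diff_divide_distrib simp del: of_nat_Suc simp flip: power_add)
  \<comment> \<open>The term j = 1 is one copy of H_{n+1} / (n + 1)^e and \<open>hsplit\<close>
    gives the other, hence the factor 2 in \<open>euler_coeff\<close>. The removed terms number e
    here and one more in \<open>hsplit\<close>.\<close>
  also have "\<dots> = harm (Suc n) / real (Suc n) ^ e + (\<Sum>j=2..e. zeta_partial (Suc n) j / real (Suc n) ^ (e + 1 - j))
      - real e / real (Suc n) ^ (e + 1)"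
    using assms zeta_partial_1[of "Suc n"] unfolding sum_subtractf
    by (simp add: sum.atLeast_Suc_atMost numeral_2_eq_2 del: of_nat_Suc)
  also note hsplit
  finally show ?thesis
    unfolding euler_coeff_def by (simp add: diff_divide_distrib add_divide_distrib del: of_nat_Suc)
qed

section \<open>Evaluation of the kernel series by integrals\<close>

lemma kernel_sums_quotient:
  assumes "b \<ge> 1"
  shows "(\<lambda>k. 1 / real (Suc k) ^ b / (real (Suc n) + real (Suc k))) sums kernel_sum b (Suc n)"
  using kernel_sums[of "Suc n" b] assms unfolding kernel_sum_def divide_divide_eq_left
  by (simp add: sums_iff del: of_nat_Suc)

text \<open>Termwise integration needs convergence first. Since \<open>Li1_Li_coeff\<close> is
  nonnegative, 1 / (n + 1)^(e+1) is at most \<open>euler_coeff e (Suc n)\<close>, and the series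
  weighted by the latter is known to converge.\<close>

lemma Li_integral_sums:
  assumes "e \<ge> 1" "b \<ge> 1"
  shows "(\<lambda>n. kernel_sum b (Suc n) / real (Suc n) ^ (e + 1)) sums Li_integral (e + 1) b"
proof -
  have kernel_nonneg: "kernel_sum b (Suc n) \<ge> 0" for n
    by (rule sums_le[OF _ sums_zero kernel_sums_quotient[OF assms(2)]]) auto
  have "summable (\<lambda>n. kernel_sum b (Suc n) / real (Suc n) ^ (e + 1))"
  proof (rule summable_comparison_test'[OF sums_summable[OF sums_euler_coeff_kernel[OF assms]]])
    fix n
    have "0 \<le> Li1_Li_coeff e n"
      unfolding Li1_Li_coeff_def by (intro sum_nonneg) auto
    moreover have "1 / real (Suc n) ^ (e + 1) \<le> (real e + 1) / real (Suc n) ^ (e + 1)"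
      by (intro divide_right_mono) auto
    ultimately have "1 / real (Suc n) ^ (e + 1) \<le> euler_coeff e (Suc n)"
      unfolding Li1_Li_coeff_eq[OF assms(1)] by linarith
    from mult_right_mono[OF this kernel_nonneg, of n]
    show "norm (kernel_sum b (Suc n) / real (Suc n) ^ (e + 1)) \<le> euler_coeff e (Suc n) * kernel_sum b (Suc n)"
      using kernel_nonneg[of n] by simp
  qed
  then obtain S where S: "(\<lambda>n. 1 / real (Suc n) ^ (e + 1) * kernel_sum b (Suc n)) sums S"
    by (auto simp: summable_def)
  have "((\<lambda>x. Li (e + 1) x * Li b x / x) has_integral S) {0..1}"
    by (rule has_integral_power_series_product[OF _ _ Li_sums Li_sums kernel_sums_quotient S]) (use assms in auto)
  then have "S = Li_integral (e + 1) b"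
    unfolding Li_integral_def by (simp add: integral_unique)
  then show ?thesis using S by simp
qed

text \<open>Second evaluation: the part of \<open>euler_coeff\<close> given by
  \<open>Li1_Li_coeff\<close> integrates to the triple integral, the correction (e + 1) / n^(e+1) to
  the double one.\<close>

lemma sums_euler_coeff_kernel_integral:
  assumes "e \<ge> 1" "b \<ge> 1"
  shows "(\<lambda>n. euler_coeff e (Suc n) * kernel_sum b (Suc n)) sums
    (triple_Li_integral 1 e b + (real e + 1) * Li_integral (e + 1) b)"
proof -
  define S where "S = (\<Sum>n. euler_coeff e (Suc n) * kernel_sum b (Suc n)) - (real e + 1) * Li_integral (e + 1) b"
  have S: "(\<lambda>n. Li1_Li_coeff e n * kernel_sum b (Suc n)) sums S"
    unfolding S_def Li1_Li_coeff_eq[OF assms(1)]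
    using sums_diff[OF summable_sums[OF sums_summable[OF sums_euler_coeff_kernel[OF assms]]]
                       sums_mult[OF Li_integral_sums[OF assms], of "real e + 1"]]
    by (simp add: left_diff_distrib del: of_nat_Suc power_Suc)
  have "((\<lambda>x. Li 1 x * Li e x * Li b x / x) has_integral S) {0..1}"
    by (rule has_integral_power_series_product[OF _ _ Li1_Li_sums Li_sums kernel_sums_quotient S])
       (use assms in \<open>auto simp: Li1_Li_coeff_def intro!: sum_nonneg\<close>)
  then have "triple_Li_integral 1 e b = S"
    unfolding triple_Li_integral_def by (simp add: integral_unique)
  then show ?thesis
    using summable_sums[OF sums_summable[OF sums_euler_coeff_kernel[OF assms]]] by (simp add: S_def)
qed

text \<open>Comparison of the two evaluations; moving the harmonic series across turns (-1)^(b-1)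
  into (-1)^b.\<close>

lemma zeta_euler_coeff_sum:
  assumes "e \<ge> 1" "b \<ge> 1"
  shows "(\<Sum>i=1..b-1. (-1) ^ (i - 1) * zeta (b + 1 - i) * (\<Sum>n. euler_coeff e (Suc n) / real (Suc n) ^ i))
    = triple_Li_integral 1 e b + (real e + 1) * Li_integral (e + 1) b
      + (-1) ^ b * (\<Sum>n. euler_coeff e (Suc n) * harm (Suc n) / real (Suc n) ^ b)"
proof -
  have "(-1) ^ b = - ((-1) ^ (b - 1) :: real)"
    using assms by (simp add: power_eq_if)
  then show ?thesis
    using sums_unique2[OF sums_euler_coeff_kernel[OF assms] sums_euler_coeff_kernel_integral[OF assms]] by simp
qed

lemma zeta_euler_sum:
  assumes "e \<ge> 1" "b \<ge> 1"
  shows "(\<Sum>i=1..b-1. (-1) ^ (i - 1) * zeta (b + 1 - i) *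
        (\<Sum>n. (\<Sum>j=2..e. zeta_partial (Suc n) j / real (Suc n) ^ (e + i + 1 - j))
             + 2 * (harm (Suc n) / real (Suc n) ^ (e + i))))
    = triple_Li_integral 1 e b + (real e + 1) * Li_integral (e + 1) b
      + (-1) ^ b * (\<Sum>n. euler_coeff e (Suc n) * harm (Suc n) / real (Suc n) ^ b)"
proof -
  have "euler_coeff e (Suc n) / real (Suc n) ^ i =
      (\<Sum>j=2..e. zeta_partial (Suc n) j / real (Suc n) ^ (e + i + 1 - j))
      + 2 * (harm (Suc n) / real (Suc n) ^ (e + i))" for n i
    unfolding euler_coeff_def add_divide_distrib sum_divide_distrib
    by (intro arg_cong2[of _ _ _ _ "(+)"] sum.cong) (auto simp: power_add[symmetric] simp del: of_nat_Suc)
  then show ?thesis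
    using zeta_euler_coeff_sum[OF assms] by (simp only:)
qed

section \<open>Recurrence in e and the series of H_n zeta_n(e) / n^b\<close>

lemma euler_coeff_Suc:
  assumes "e \<ge> 1"
  shows "euler_coeff (Suc e) (Suc n) = euler_coeff e (Suc n) / real (Suc n) + zeta_partial (Suc n) (Suc e) / real (Suc n)"
proof -
  have "(\<Sum>j=2..e. zeta_partial (Suc n) j / real (Suc n) ^ (Suc e + 1 - j))
      = (\<Sum>j=2..e. zeta_partial (Suc n) j / real (Suc n) ^ (e + 1 - j)) / real (Suc n)"
    unfolding sum_divide_distrib by (intro sum.cong) (auto simp: Suc_diff_le simp del: of_nat_Suc)
  then show ?thesis
    using assms by (simp add: euler_coeff_def add_divide_distrib del: of_nat_Suc)
qed

lemma Li_integral_commute: "Li_integral a b = Li_integral b a"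
  unfolding Li_integral_def by (simp add: mult.commute)

lemma triple_Li_integral_commute: "triple_Li_integral a b c = triple_Li_integral a c b"
  unfolding triple_Li_integral_def by (simp add: mult_ac)

definition euler_harm_sum :: "nat \<Rightarrow> nat \<Rightarrow> real" where
  "euler_harm_sum e b = (\<Sum>n. euler_coeff e (Suc n) * harm (Suc n) / real (Suc n) ^ b)"

text \<open>The recurrence \<open>euler_coeff_Suc\<close>, multiplied by H_n / n^(b-1), writes each
  term as a difference of terms of two convergent series.\<close>

lemma sums_harm_zeta_partial:
  assumes "e \<ge> 2" "b \<ge> 2"
  shows "(\<lambda>n. harm (Suc n) * zeta_partial (Suc n) e / real (Suc n) ^ b) sums
           (euler_harm_sum e (b - 1) - euler_harm_sum (e - 1) b)"
proof -
  obtain d c where e: "e = Suc d" and b: "b = Suc c" and "d \<ge> 1" "c \<ge> 1"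
    using assms by (cases e; cases b) auto
  have "harm (Suc n) * zeta_partial (Suc n) e / real (Suc n) ^ b =
      euler_coeff e (Suc n) * harm (Suc n) / real (Suc n) ^ c - euler_coeff d (Suc n) * harm (Suc n) / real (Suc n) ^ b" for n
    unfolding e b euler_coeff_Suc[OF \<open>d \<ge> 1\<close>] by (simp add: divide_simps del: of_nat_Suc) (simp add: algebra_simps del: of_nat_Suc)
  then show ?thesis
    using \<open>d \<ge> 1\<close> \<open>c \<ge> 1\<close> unfolding euler_harm_sum_def e b
    by (auto intro!: sums_diff summable_sums summable_euler_coeff simp del: of_nat_Suc power_Suc)
qed

theorem theorem2p8:
  fixes p m :: nat
  assumes "p \<ge> 2"
  shows
    "(-1) ^ p * (\<Sum>n. harm (Suc n) * zeta_partial (Suc n) (p + 2*m + 2) / real (Suc n) ^ p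
                     - harm (Suc n) * zeta_partial (Suc n) p / real (Suc n) ^ (p + 2*m + 2))
   = (\<Sum>i=1..p + 2*m + 1. (-1) ^ (i - 1) * zeta (p + 2*m + 3 - i) *
        (\<Sum>n. (\<Sum>j=2..p - 1. zeta_partial (Suc n) j / real (Suc n) ^ (p + i - j))
             + 2 * (harm (Suc n) / real (Suc n) ^ (p - 1 + i))))
   + (\<Sum>i=1..p + 2*m. (-1) ^ (i - 1) * zeta (p + 2*m + 2 - i) *
        (\<Sum>n. (\<Sum>j=2..p. zeta_partial (Suc n) j / real (Suc n) ^ (p + i + 1 - j))
             + 2 * (harm (Suc n) / real (Suc n) ^ (p + i))))
   - (\<Sum>i=1..p - 2. (-1) ^ (i - 1) * zeta (p - i) *
        (\<Sum>n. (\<Sum>j=2..p + 2*m + 2. zeta_partial (Suc n) j / real (Suc n) ^ (p + 2*m + i + 3 - j))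
             + 2 * (harm (Suc n) / real (Suc n) ^ (p + 2*m + 2 + i))))
   - (\<Sum>i=1..p - 1. (-1) ^ (i - 1) * zeta (p + 1 - i) *
        (\<Sum>n. (\<Sum>j=2..p + 2*m + 1. zeta_partial (Suc n) j / real (Suc n) ^ (p + 2*m + i + 2 - j))
             + 2 * (harm (Suc n) / real (Suc n) ^ (p + 2*m + i + 1))))
   + real (p + 2*m + 3) * Li_integral (p - 1) (p + 2*m + 3)
   + real (2*m + 2) * Li_integral p (p + 2*m + 2)
   - real (p + 1) * Li_integral (p + 1) (p + 2*m + 1)"
proof -
  have B1: "(\<Sum>i=1..p + 2*m + 1. (-1) ^ (i - 1) * zeta (p + 2*m + 3 - i) *
        (\<Sum>n. (\<Sum>j=2..p - 1. zeta_partial (Suc n) j / real (Suc n) ^ (p + i - j))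
             + 2 * (harm (Suc n) / real (Suc n) ^ (p - 1 + i))))
      = triple_Li_integral 1 (p - 1) (p + 2*m + 2) + real p * Li_integral p (p + 2*m + 2) + (-1) ^ (p + 2*m + 2) * euler_harm_sum (p - 1) (p + 2*m + 2)"
  proof -
    have idx: "p - 1 + i + 1 - j = p + i - j"
      "p + 2*m + 2 + 1 - i = p + 2*m + 3 - i"
      "p + 2*m + 2 - 1 = p + 2*m + 1"
      "p - 1 + 1 = p"
      "real (p - 1) + 1 = real p" for i j
      using assms by (auto simp: of_nat_diff)
    show ?thesis
      using zeta_euler_sum[of "p - 1" "p + 2*m + 2"] assms unfolding idx euler_harm_sum_def by simp
  qed
  have B2: "(\<Sum>i=1..p + 2*m. (-1) ^ (i - 1) * zeta (p + 2*m + 2 - i) *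
        (\<Sum>n. (\<Sum>j=2..p. zeta_partial (Suc n) j / real (Suc n) ^ (p + i + 1 - j))
             + 2 * (harm (Suc n) / real (Suc n) ^ (p + i))))
      = triple_Li_integral 1 p (p + 2*m + 1) + real (p + 1) * Li_integral (p + 1) (p + 2*m + 1) + (-1) ^ (p + 2*m + 1) * euler_harm_sum p (p + 2*m + 1)"
  proof -
    have idx: "p + 2*m + 1 + 1 - i = p + 2*m + 2 - i"
      "p + 2*m + 1 - 1 = p + 2*m"
      "real p + 1 = real (p + 1)" for i
      using assms by (auto simp: of_nat_diff)
    show ?thesis
      using zeta_euler_sum[of "p" "p + 2*m + 1"] assms unfolding idx euler_harm_sum_def by simp
  qed
  \<comment> \<open>For p = 2 this is the case b = 1: the sum over i is empty and the right-hand
    side is zero.\<close>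
  have B3: "(\<Sum>i=1..p - 2. (-1) ^ (i - 1) * zeta (p - i) *
        (\<Sum>n. (\<Sum>j=2..p + 2*m + 2. zeta_partial (Suc n) j / real (Suc n) ^ (p + 2*m + i + 3 - j))
             + 2 * (harm (Suc n) / real (Suc n) ^ (p + 2*m + 2 + i))))
      = triple_Li_integral 1 (p + 2*m + 2) (p - 1) + real (p + 2*m + 3) * Li_integral (p + 2*m + 3) (p - 1) + (-1) ^ (p - 1) * euler_harm_sum (p + 2*m + 2) (p - 1)"
  proof -
    have idx: "p + 2*m + 2 + i + 1 - j = p + 2*m + i + 3 - j"
      "p - 1 + 1 = p"
      "p - 1 - 1 = p - 2"
      "p + 2*m + 2 + 1 = p + 2*m + 3"
      "real (p + 2*m + 2) + 1 = real (p + 2*m + 3)" for i j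
      using assms by (auto simp: of_nat_diff)
    show ?thesis
      using zeta_euler_sum[of "p + 2*m + 2" "p - 1"] assms unfolding idx euler_harm_sum_def by simp
  qed
  have B4: "(\<Sum>i=1..p - 1. (-1) ^ (i - 1) * zeta (p + 1 - i) *
        (\<Sum>n. (\<Sum>j=2..p + 2*m + 1. zeta_partial (Suc n) j / real (Suc n) ^ (p + 2*m + i + 2 - j))
             + 2 * (harm (Suc n) / real (Suc n) ^ (p + 2*m + i + 1))))
      = triple_Li_integral 1 (p + 2*m + 1) p + real (p + 2*m + 2) * Li_integral (p + 2*m + 2) p + (-1) ^ p * euler_harm_sum (p + 2*m + 1) p"
  proof -
    have idx: "p + 2*m + 1 + i + 1 - j = p + 2*m + i + 2 - j"
      "real n ^ (p + 2*m + 1 + i) = real n ^ (p + 2*m + i + 1)"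
      "p + 2*m + 1 + 1 = p + 2*m + 2"
      "real (p + 2*m + 1) + 1 = real (p + 2*m + 2)" for i j n
      using assms by (auto simp: of_nat_diff)
    show ?thesis
      using zeta_euler_sum[of "p + 2*m + 1" "p"] assms unfolding idx euler_harm_sum_def by simp
  qed
  \<comment> \<open>The cases (e, b) = (q, p) and (p, q) of \<open>sums_harm_zeta_partial\<close>,
    with q = p + 2m + 2; they leave exactly the four harmonic series of the blocks.\<close>
  have lhs: "(\<Sum>n. harm (Suc n) * zeta_partial (Suc n) (p + 2*m + 2) / real (Suc n) ^ p
            - harm (Suc n) * zeta_partial (Suc n) p / real (Suc n) ^ (p + 2*m + 2))
      = (euler_harm_sum (p + 2*m + 2) (p - 1) - euler_harm_sum (p + 2*m + 1) p)
        - (euler_harm_sum p (p + 2*m + 1) - euler_harm_sum (p - 1) (p + 2*m + 2))"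
    using sums_diff[OF sums_harm_zeta_partial[of "p + 2*m + 2" p] sums_harm_zeta_partial[of p "p + 2*m + 2"]] assms
    by (simp add: sums_iff)
  \<comment> \<open>q and p have the same parity, so the signs of the blocks agree with those in
    \<open>lhs\<close>.\<close>
  have signs: "(-1) ^ (p + 2*m + 2) = ((-1) ^ p :: real)" "(-1) ^ (p + 2*m + 1) = - ((-1) ^ p :: real)"
    "(-1) ^ (p - 1) = - ((-1) ^ p :: real)"
    using assms by (simp_all add: power_add power_mult) (cases p; simp)
  \<comment> \<open>The triple integrals of \<open>B1\<close> and \<open>B3\<close>, and of
    \<open>B2\<close> and \<open>B4\<close>, cancel. For I_{p,q} the blocks leave p - (p + 2m + 2) =
    -(2m + 2), which the explicit term removes; the other two double integrals cancel
    directly.\<close>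
  show ?thesis
    unfolding B1 B2 B3 B4 lhs signs Li_integral_commute[of p "p + 2*m + 2"] Li_integral_commute[of "p - 1" "p + 2*m + 3"]
      triple_Li_integral_commute[of 1 "p - 1" "p + 2*m + 2"] triple_Li_integral_commute[of 1 p "p + 2*m + 1"]
    by (simp add: algebra_simps)
qed

end
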